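(* There is a deterministic primal-dual algorithm for the Online Dominating Set Leasing problem (ODSL) with $\mathcal{O}(|\mathcal{L}|\cdot\Delta)$-competitive ratio, where $\Delta$ is the maximum degree of the input graph and $|\mathcal{L}|$ is the number of available lease types.
   Context: Online Dominating Set Leasing (ODSL). Given are an undirected connected graph $G=(V,E)$, a set $\mathcal{L}$ of lease types, where each $l\in\mathcal{L}$ is characterized by a duration $d_l$ and a cost $c_l$, and a sequence of subsets of $V$ arriving over time. A node leased using lease type $l$ incurs cost $c_l$ (the same for all nodes) and remains active for time $d_l$; once a lease expires, it has to be paid for again if the node is to be active again. Lease configuration (assumed throughout): all lease durations are powers of two, and a node can be leased with type $l$ only with a starting time that is a multiple of $d_l$. Thus, at any time $t$ and for any node $u$, exactly $|\mathcal{L}|$ leases of $u$ (one per type) cover time $t$; at step $t$ the algorithm may buy any of the leases covering time $t$, paying the full cost $c_l$. A node is dominated by a subset $S$ of $V$ if it is either in $S$ or has an adjacent node in $S$. In each step $t$, the adversary gives a subset $D_t\subseteq V$ of nodes that need to be dominated by nodes active at time $t$; the subgraph induced by the dominating nodes is not required to be connected. The goal is to minimize the total leasing cost. An online algorithm must satisfy the requirement of step $t$ when $D_t$ is revealed, by irrevocably buying leases, without knowledge of the later subsets. A deterministic online algorithm has an $\mathcal{O}(f)$-competitive ratio if it always produces a feasible solution and its total leasing cost is at most $\mathcal{O}(f)$ times $Opt$, where $Opt$ is the cost of an optimal offline solution, i.e. the minimum cost of a feasible solution when the whole sequence is known in advance. "Primal-dual" means that the algorithm is based on the covering integer program for ODSL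 (one 0/1 variable per lease, one covering constraint per requested node at its time of request) and its dual, with the ratio proved by weak duality. *)

theory Defs
  imports Complex_Main "Graph_Theory.Graph_Theory"
begin

text \<open>
  Undirected simple graphs are the symmetric digraphs \<^locale>\<open>pair_graph\<close>: every edge \<open>{u, v}\<close>
  is present as both \<open>(u, v)\<close> and \<open>(v, u)\<close>, so the degree of a node is its out-degree.
\<close>

record ('v, 'l) odsl =
  network :: "'v pair_pre_digraph"
  lease_types :: "'l set"
  duration :: "'l \<Rightarrow> nat"
  price :: "'l \<Rightarrow> real"

definition odsl_instance :: "('v, 'l) odsl \<Rightarrow> bool" where
  "odsl_instance I \<longleftrightarrow>
     pair_graph (network I) \<and> Digraph_Component.connected (with_proj (network I)) \<and>
     finite (lease_types I) \<and> lease_types I \<noteq> {} \<and>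
     (\<forall>l \<in> lease_types I. (\<exists>k. duration I l = 2 ^ k) \<and> 0 \<le> price I l)"

definition max_degree :: "('v, 'l) odsl \<Rightarrow> nat" where
  "max_degree I = Max (out_degree (with_proj (network I)) ` pverts (network I))"

definition requests :: "('v, 'l) odsl \<Rightarrow> 'v set list \<Rightarrow> bool" where
  "requests I Ds \<longleftrightarrow> (\<forall>D \<in> set Ds. D \<subseteq> pverts (network I))"

definition dominated :: "'v pair_pre_digraph \<Rightarrow> 'v set \<Rightarrow> 'v \<Rightarrow> bool" where
  "dominated G S v \<longleftrightarrow> v \<in> S \<or> (\<exists>u \<in> S. (u, v) \<in> parcs G)"

text \<open>
  A lease \<open>(u, l, s)\<close> of node \<open>u\<close> with type \<open>l\<close> and starting time \<open>s\<close> is active during the time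
  steps \<open>s, \<dots>, s + duration I l - 1\<close>. Time steps are numbered from 0, the set \<open>Ds ! t\<close> being
  revealed at time \<open>t\<close>; a sequence starting later is obtained by prepending empty sets.
\<close>

type_synonym ('v, 'l) lease = "'v \<times> 'l \<times> nat"

definition leases_at :: "('v, 'l) odsl \<Rightarrow> nat \<Rightarrow> ('v, 'l) lease set" where
  "leases_at I t = {(u, l, s). u \<in> pverts (network I) \<and> l \<in> lease_types I \<and>
     duration I l dvd s \<and> s \<le> t \<and> t < s + duration I l}"

definition leases :: "('v, 'l) odsl \<Rightarrow> nat \<Rightarrow> ('v, 'l) lease set" where
  "leases I T = (\<Union>t<T. leases_at I t)"

definition lease_cost :: "('v, 'l) odsl \<Rightarrow> ('v, 'l) lease \<Rightarrow> real" where
  "lease_cost I = (\<lambda>(u, l, s). price I l)"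

definition active :: "('v, 'l) odsl \<Rightarrow> ('v, 'l) lease set \<Rightarrow> nat \<Rightarrow> 'v set" where
  "active I X t = fst ` (X \<inter> leases_at I t)"

definition served :: "('v, 'l) odsl \<Rightarrow> 'v set list \<Rightarrow> ('v, 'l) lease set \<Rightarrow> nat \<Rightarrow> bool" where
  "served I Ds X t \<longleftrightarrow> (\<forall>v \<in> Ds ! t. dominated (network I) (active I X t) v)"

definition offline_solution :: "('v, 'l) odsl \<Rightarrow> 'v set list \<Rightarrow> ('v, 'l) lease set \<Rightarrow> bool" where
  "offline_solution I Ds X \<longleftrightarrow>
     X \<subseteq> leases I (length Ds) \<and> (\<forall>t < length Ds. served I Ds X t)"

text \<open>
  On instances, the solutions form a finite nonempty family (buying all leases is one of them),
  so \<^const>\<open>Min\<close> below is a genuine minimum.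
\<close>

definition Opt :: "('v, 'l) odsl \<Rightarrow> 'v set list \<Rightarrow> real" where
  "Opt I Ds = Min ((\<lambda>X. \<Sum>a\<in>X. lease_cost I a) ` {X. offline_solution I Ds X})"

text \<open>
  A deterministic online algorithm is a function that, given the instance (graph and lease types)
  and the request sets revealed so far, the last one being the current one, returns the set of
  leases to buy in the current step.
\<close>

type_synonym ('v, 'l) online_alg = "('v, 'l) odsl \<Rightarrow> 'v set list \<Rightarrow> ('v, 'l) lease set"

definition purchases ::
  "('v, 'l) online_alg \<Rightarrow> ('v, 'l) odsl \<Rightarrow> 'v set list \<Rightarrow> nat \<Rightarrow> ('v, 'l) lease set" where
  "purchases A I Ds t = A I (take (Suc t) Ds)"

definition online_feasible :: "('v, 'l) online_alg \<Rightarrow> ('v, 'l) odsl \<Rightarrow> 'v set list \<Rightarrow> bool" where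
  "online_feasible A I Ds \<longleftrightarrow> (\<forall>t < length Ds.
     purchases A I Ds t \<subseteq> leases_at I t \<and> served I Ds (\<Union>i\<le>t. purchases A I Ds i) t)"

definition online_cost :: "('v, 'l) online_alg \<Rightarrow> ('v, 'l) odsl \<Rightarrow> 'v set list \<Rightarrow> real" where
  "online_cost A I Ds = (\<Sum>t<length Ds. \<Sum>a\<in>purchases A I Ds t. lease_cost I a)"

text \<open>
  The constant hidden in the \<open>O\<close>-notation is uniform in the instance and the request sequence.
\<close>

definition competitive :: "(('v, 'l) odsl \<Rightarrow> real) \<Rightarrow> ('v, 'l) online_alg \<Rightarrow> bool" where
  "competitive f A \<longleftrightarrow> (\<exists>C>0. \<forall>I Ds. odsl_instance I \<longrightarrow> requests I Ds \<longrightarrow>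
     online_feasible A I Ds \<and> online_cost A I Ds \<le> C * f I * Opt I Ds)"

text \<open>
  The covering integer program of a request sequence \<open>Ds\<close>:
  minimize \<open>\<Sum>a. lease_cost I a * x a\<close> subject to \<open>\<Sum>a\<in>candidates I r. x a \<ge> 1\<close> for every
  requested pair \<open>r = (t, v)\<close> and \<open>x a \<in> {0, 1}\<close>, with one variable per lease. The dual of its linear
  relaxation: maximize \<open>\<Sum>r. y r\<close> subject to \<open>\<Sum>r. y r \<le> lease_cost I a\<close> for every lease \<open>a\<close>,
  the sum ranging over the \<open>r\<close> with \<open>a \<in> candidates I r\<close>, and \<open>y r \<ge> 0\<close>.
\<close>

definition constraints :: "'v set list \<Rightarrow> (nat \<times> 'v) set" where
  "constraints Ds = {(t, v). t < length Ds \<and> v \<in> Ds ! t}"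

definition candidates :: "('v, 'l) odsl \<Rightarrow> nat \<times> 'v \<Rightarrow> ('v, 'l) lease set" where
  "candidates I = (\<lambda>(t, v). {a \<in> leases_at I t. fst a = v \<or> (fst a, v) \<in> parcs (network I)})"

definition primal_feasible ::
  "('v, 'l) odsl \<Rightarrow> 'v set list \<Rightarrow> (('v, 'l) lease \<Rightarrow> real) \<Rightarrow> bool" where
  "primal_feasible I Ds x \<longleftrightarrow>
     (\<forall>a \<in> leases I (length Ds). x a \<in> {0, 1}) \<and>
     (\<forall>r \<in> constraints Ds. (\<Sum>a\<in>candidates I r. x a) \<ge> 1)"

definition primal_value ::
  "('v, 'l) odsl \<Rightarrow> 'v set list \<Rightarrow> (('v, 'l) lease \<Rightarrow> real) \<Rightarrow> real" where
  "primal_value I Ds x = (\<Sum>a\<in>leases I (length Ds). lease_cost I a * x a)"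

definition dual_feasible ::
  "('v, 'l) odsl \<Rightarrow> 'v set list \<Rightarrow> (nat \<times> 'v \<Rightarrow> real) \<Rightarrow> bool" where
  "dual_feasible I Ds y \<longleftrightarrow>
     (\<forall>r \<in> constraints Ds. 0 \<le> y r) \<and>
     (\<forall>a \<in> leases I (length Ds).
        (\<Sum>r | r \<in> constraints Ds \<and> a \<in> candidates I r. y r) \<le> lease_cost I a)"

definition dual_value :: "'v set list \<Rightarrow> (nat \<times> 'v \<Rightarrow> real) \<Rightarrow> real" where
  "dual_value Ds y = (\<Sum>r\<in>constraints Ds. y r)"

text \<open>
  A primal-dual algorithm constructs, online and irrevocably, a solution of the covering program
  (by its purchases \<open>A\<close>) together with a solution of the dual (by \<open>Y\<close>, which assigns values to the
  dual variables of the constraints revealed in the current step). Its cost is bounded against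
  the value of the dual, which by weak duality is a lower bound on the optimum.
\<close>

type_synonym ('v, 'l) online_dual = "('v, 'l) odsl \<Rightarrow> 'v set list \<Rightarrow> 'v \<Rightarrow> real"

definition primal_solution ::
  "('v, 'l) online_alg \<Rightarrow> ('v, 'l) odsl \<Rightarrow> 'v set list \<Rightarrow> ('v, 'l) lease \<Rightarrow> real" where
  "primal_solution A I Ds a = of_bool (\<exists>t < length Ds. a \<in> purchases A I Ds t)"

definition dual_solution ::
  "('v, 'l) online_dual \<Rightarrow> ('v, 'l) odsl \<Rightarrow> 'v set list \<Rightarrow> nat \<times> 'v \<Rightarrow> real" where
  "dual_solution Y I Ds = (\<lambda>(t, v). Y I (take (Suc t) Ds) v)"

definition primal_dual ::
  "(('v, 'l) odsl \<Rightarrow> real) \<Rightarrow> ('v, 'l) online_alg \<Rightarrow> ('v, 'l) online_dual \<Rightarrow> bool" where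
  "primal_dual f A Y \<longleftrightarrow> (\<exists>C>0. \<forall>I Ds. odsl_instance I \<longrightarrow> requests I Ds \<longrightarrow>
     primal_feasible I Ds (primal_solution A I Ds) \<and>
     dual_feasible I Ds (dual_solution Y I Ds) \<and>
     online_cost A I Ds = primal_value I Ds (primal_solution A I Ds) \<and>
     primal_value I Ds (primal_solution A I Ds) \<le> C * f I * dual_value Ds (dual_solution Y I Ds))"

end

theory Submission
  imports Defs "HOL-Library.Disjoint_Sets"
begin

text \<open>
  When \<open>D\<^sub>t\<close> arrives, its dual variables are raised to a maximal dual solution: no constraint of
  a lease is violated, and every requested node has a candidate lease whose constraint is tight.
  The algorithm buys each lease the first time it is tight while being available. A bought lease
  is paid by the dual variables in its constraint, and each dual variable occurs in the constraints
  of at most \<open>(\<Delta> + 1) * card (lease_types I) \<le> 2 * max 1 \<Delta> * card (lease_types I)\<close> leases.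
\<close>

section \<open>Instances\<close>

lemma candidates_subset: "candidates I (t, v) \<subseteq> leases_at I t"
  by (auto simp: candidates_def)

lemma
  assumes "odsl_instance I"
  shows finite_pverts: "finite (pverts (network I))"
    and finite_lease_types: "finite (lease_types I)"
    and sym_parcs: "(u, v) \<in> parcs (network I) \<Longrightarrow> (v, u) \<in> parcs (network I)"
proof -
  from assms interpret pair_graph "network I"
    by (simp add: odsl_instance_def)
  show "finite (pverts (network I))"
    by (rule pair_finite_verts)
  show "finite (lease_types I)"
    using assms by (simp add: odsl_instance_def)
  show "(u, v) \<in> parcs (network I) \<Longrightarrow> (v, u) \<in> parcs (network I)"
    using arcs_symmetric by blast
qed

lemma duration_pos:
  assumes "odsl_instance I" "l \<in> lease_types I"
  shows "0 < duration I l"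
proof -
  from assms obtain k where "duration I l = 2 ^ k"
    unfolding odsl_instance_def by blast
  then show ?thesis by simp
qed

lemma lease_cost_nonneg:
  assumes "odsl_instance I" "a \<in> leases_at I t"
  shows "0 \<le> lease_cost I a"
  using assms by (auto simp: odsl_instance_def leases_at_def lease_cost_def)

lemma finite_leases_at:
  assumes "odsl_instance I"
  shows "finite (leases_at I t)"
proof (rule finite_subset)
  show "leases_at I t \<subseteq> pverts (network I) \<times> lease_types I \<times> {..t}"
    by (auto simp: leases_at_def)
  show "finite (pverts (network I) \<times> lease_types I \<times> {..t})"
    using finite_pverts[OF assms] finite_lease_types[OF assms] by simp
qed

lemma finite_leases: "odsl_instance I \<Longrightarrow> finite (leases I T)"
  by (simp add: leases_def finite_leases_at)

lemma finite_candidates: "odsl_instance I \<Longrightarrow> finite (candidates I (t, v))"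
  by (rule finite_subset[OF candidates_subset finite_leases_at])

lemma candidates_nonempty:
  assumes I: "odsl_instance I" and v: "v \<in> pverts (network I)"
  shows "candidates I (t, v) \<noteq> {}"
proof -
  from I obtain l where l: "l \<in> lease_types I"
    by (auto simp: odsl_instance_def)
  define d where "d = duration I l"
  have "0 < d"
    using duration_pos[OF I l] by (simp add: d_def)
  then have "t < t div d * d + d"
    by (metis div_mult_mod_eq mod_less_divisor nat_add_left_cancel_less)
  then have "(v, l, t div d * d) \<in> candidates I (t, v)"
    using l v by (simp add: candidates_def leases_at_def d_def)
  then show ?thesis by blast
qed

lemma card_in_neighbours:
  assumes I: "odsl_instance I" and v: "v \<in> pverts (network I)"
  shows "finite {u. (u, v) \<in> parcs (network I)}"
    and "card {u. (u, v) \<in> parcs (network I)} \<le> max_degree I"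
proof -
  from I interpret pair_graph "network I"
    by (simp add: odsl_instance_def)
  have eq: "{u. (u, v) \<in> parcs (network I)} = snd ` out_arcs (with_proj (network I)) v"
    using sym_parcs[OF I] by (force simp: out_arcs_def)
  have fin: "finite (out_arcs (with_proj (network I)) v)"
    by (rule finite_subset[OF _ pair_finite_arcs]) (auto simp: out_arcs_def)
  then show "finite {u. (u, v) \<in> parcs (network I)}"
    by (simp add: eq)
  have "card {u. (u, v) \<in> parcs (network I)} \<le> out_degree (with_proj (network I)) v"
    unfolding eq out_degree_def using fin by (rule card_image_le)
  also have "\<dots> \<le> max_degree I"
    unfolding max_degree_def using v finite_pverts[OF I] by (intro Max_ge) auto
  finally show "card {u. (u, v) \<in> parcs (network I)} \<le> max_degree I" .
qed

lemma card_candidates_le: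
  assumes I: "odsl_instance I" and v: "v \<in> pverts (network I)"
  shows "card (candidates I (t, v)) \<le> (max_degree I + 1) * card (lease_types I)"
proof -
  define N where "N = insert v {u. (u, v) \<in> parcs (network I)}"
  have N: "finite N" "card N \<le> max_degree I + 1"
    using card_in_neighbours[OF I v] by (auto simp: N_def card_insert_if)
  have start: "s = t div d * d" if "d dvd s" "s \<le> t" "t < s + d" for s d :: nat
  proof -
    from that(1) obtain k where k: "s = d * k" ..
    have "t div d = k"
      by (rule div_nat_eqI) (use that k in \<open>auto simp: algebra_simps\<close>)
    with k show ?thesis by simp
  qed
  have "candidates I (t, v) \<subseteq>
    (\<lambda>(u, l). (u, l, t div duration I l * duration I l)) ` (N \<times> lease_types I)"
  proof
    fix a assume "a \<in> candidates I (t, v)"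
    then obtain u l s where a: "a = (u, l, s)" "(u, l) \<in> N \<times> lease_types I"
      "duration I l dvd s" "s \<le> t" "t < s + duration I l"
      by (auto simp: candidates_def leases_at_def N_def)
    from a(1) start[OF a(3-5)] have "a = (\<lambda>(u, l). (u, l, t div duration I l * duration I l)) (u, l)"
      by simp
    then show "a \<in> (\<lambda>(u, l). (u, l, t div duration I l * duration I l)) ` (N \<times> lease_types I)"
      using a(2) by (rule image_eqI)
  qed
  then have "card (candidates I (t, v)) \<le> card (N \<times> lease_types I)"
    using N(1) finite_lease_types[OF I] by (intro surj_card_le) auto
  also have "\<dots> \<le> (max_degree I + 1) * card (lease_types I)"
    using N(2) by (simp only: card_cartesian_product mult_le_mono1)
  finally show ?thesis .
qed

lemma requested_in_pverts:
  "requests I Ds \<Longrightarrow> (t, v) \<in> constraints Ds \<Longrightarrow> v \<in> pverts (network I)"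
  by (auto simp: requests_def constraints_def set_conv_nth)

lemma finite_constraints:
  assumes "odsl_instance I" "requests I Ds"
  shows "finite (constraints Ds)"
proof (rule finite_subset)
  show "constraints Ds \<subseteq> {..<length Ds} \<times> pverts (network I)"
    using requested_in_pverts[OF assms(2)] by (auto simp: constraints_def)
  show "finite ({..<length Ds} \<times> pverts (network I))"
    using finite_pverts[OF assms(1)] by simp
qed

lemma constraints_Nil: "constraints [] = {}"
  by (simp add: constraints_def)

lemma constraints_snoc: "constraints (Ds @ [D]) = constraints Ds \<union> Pair (length Ds) ` D"
  by (auto simp: constraints_def nth_append less_Suc_eq)

lemma served_iff:
  "served I Ds X t \<longleftrightarrow> (\<forall>v \<in> Ds ! t. X \<inter> candidates I (t, v) \<noteq> {})"
  by (auto simp: served_def dominated_def active_def candidates_def)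

section \<open>Weak duality\<close>

lemma dual_value_le_offline_cost:
  assumes I: "odsl_instance I" and Ds: "requests I Ds"
    and y: "dual_feasible I Ds y" and X: "offline_solution I Ds X"
  shows "dual_value Ds y \<le> (\<Sum>a\<in>X. lease_cost I a)"
proof -
  have XL: "X \<subseteq> leases I (length Ds)"
    using X by (simp add: offline_solution_def)
  then have fin: "finite X" "finite (constraints Ds)"
    using finite_leases[OF I] finite_constraints[OF I Ds] by (auto intro: finite_subset)
  have "dual_value Ds y \<le> (\<Sum>r\<in>constraints Ds. \<Sum>a | a \<in> X \<and> a \<in> candidates I r. y r)"
    unfolding dual_value_def
  proof (rule sum_mono)
    fix r assume r: "r \<in> constraints Ds"
    then obtain a where "a \<in> X \<and> a \<in> candidates I r"
      using X by (fastforce simp: offline_solution_def served_iff constraints_def)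
    moreover have "0 \<le> y r"
      using y r by (simp add: dual_feasible_def)
    ultimately show "y r \<le> (\<Sum>a | a \<in> X \<and> a \<in> candidates I r. y r)"
      using fin(1) by (intro member_le_sum[where f = "\<lambda>_. y r" and i = a]) auto
  qed
  also have "\<dots> = (\<Sum>a\<in>X. \<Sum>r | r \<in> constraints Ds \<and> a \<in> candidates I r. y r)"
    using fin by (intro sum.swap_restrict)
  also have "\<dots> \<le> (\<Sum>a\<in>X. lease_cost I a)"
    using y XL by (intro sum_mono) (auto simp: dual_feasible_def)
  finally show ?thesis .
qed

lemma dual_value_le_Opt:
  assumes I: "odsl_instance I" and Ds: "requests I Ds" and y: "dual_feasible I Ds y"
  shows "dual_value Ds y \<le> Opt I Ds"
proof -
  have "offline_solution I Ds (leases I (length Ds))"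
    unfolding offline_solution_def served_iff
  proof (intro conjI allI impI ballI)
    fix t v assume t: "t < length Ds" and v: "v \<in> Ds ! t"
    have "v \<in> pverts (network I)"
      using requested_in_pverts[OF Ds] t v by (auto simp: constraints_def)
    then obtain a where "a \<in> candidates I (t, v)"
      using candidates_nonempty[OF I] by blast
    moreover from this have "a \<in> leases I (length Ds)"
      using candidates_subset t by (fastforce simp: leases_def)
    ultimately show "leases I (length Ds) \<inter> candidates I (t, v) \<noteq> {}"
      by blast
  qed simp
  then have "{X. offline_solution I Ds X} \<noteq> {}"
    by blast
  moreover have "finite {X. offline_solution I Ds X}"
    by (rule finite_subset[of _ "Pow (leases I (length Ds))"])
      (auto simp: offline_solution_def finite_leases[OF I])
  ultimately show ?thesis
    unfolding Opt_def using dual_value_le_offline_cost[OF I Ds y] by (subst Min_ge_iff) auto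
qed

section \<open>Maximal dual increments\<close>

definition maximal_increment ::
  "('a \<Rightarrow> real) \<Rightarrow> ('v \<Rightarrow> 'a set) \<Rightarrow> 'v set \<Rightarrow> ('a \<Rightarrow> real) \<Rightarrow> ('v \<Rightarrow> real) \<Rightarrow> bool" where
  "maximal_increment c N D l y \<longleftrightarrow>
     (\<forall>v. 0 \<le> y v) \<and>
     (\<forall>a. l a \<le> c a \<longrightarrow> l a + (\<Sum>v | v \<in> D \<and> a \<in> N v. y v) \<le> c a) \<and>
     (\<forall>v\<in>D. \<exists>a\<in>N v. l a + (\<Sum>w | w \<in> D \<and> a \<in> N w. y w) = c a)"

lemma maximal_increment_exists:
  assumes "finite D" and "\<And>v. v \<in> D \<Longrightarrow> finite (N v) \<and> N v \<noteq> {}"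
    and "\<And>v a. v \<in> D \<Longrightarrow> a \<in> N v \<Longrightarrow> l a \<le> c a"
  shows "\<exists>y. maximal_increment c N D l y"
  using assms
proof (induction D)
  case empty
  show ?case
    by (rule exI[of _ "\<lambda>_. 0"]) (simp add: maximal_increment_def)
next
  case (insert w F)
  then obtain y where y: "maximal_increment c N F l y"
    by auto
  define load where "load a = l a + (\<Sum>v | v \<in> F \<and> a \<in> N v. y v)" for a
  have load_le: "load a \<le> c a" if "l a \<le> c a" for a
    using y that by (simp add: maximal_increment_def load_def)
  define slack where "slack = Min ((\<lambda>a. c a - load a) ` N w)"
  have Nw: "finite (N w)" "N w \<noteq> {}"
    using insert.prems(1)[of w] by auto
  have slack_le: "slack \<le> c a - load a" if "a \<in> N w" for a
    unfolding slack_def using Nw that by (intro Min_le) auto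
  have "slack \<in> (\<lambda>a. c a - load a) ` N w"
    unfolding slack_def using Nw by (intro Min_in) auto
  then obtain b where b: "b \<in> N w" "slack = c b - load b"
    by blast
  have slack_nonneg: "0 \<le> slack"
    using b load_le[of b] insert.prems(2)[of w b] by simp
  have load': "l a + (\<Sum>v | v \<in> insert w F \<and> a \<in> N v. (y(w := slack)) v) =
      load a + (if a \<in> N w then slack else 0)" for a
  proof -
    have old: "(\<Sum>v | v \<in> F \<and> a \<in> N v. (y(w := slack)) v) = (\<Sum>v | v \<in> F \<and> a \<in> N v. y v)"
      using insert.hyps(2) by (intro sum.cong) auto
    show ?thesis
    proof (cases "a \<in> N w")
      case True
      then have "{v. v \<in> insert w F \<and> a \<in> N v} = insert w {v. v \<in> F \<and> a \<in> N v}"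
        by auto
      then show ?thesis
        using True insert.hyps by (simp add: old load_def del: fun_upd_apply) simp
    next
      case False
      then have "{v. v \<in> insert w F \<and> a \<in> N v} = {v. v \<in> F \<and> a \<in> N v}"
        by auto
      then show ?thesis
        using False by (simp only: old load_def if_False add_0_right)
    qed
  qed
  have "maximal_increment c N (insert w F) l (y(w := slack))"
    unfolding maximal_increment_def load'
  proof (intro conjI allI impI ballI)
    show "0 \<le> (y(w := slack)) v" for v
      using y slack_nonneg by (simp add: maximal_increment_def)
    show "load a + (if a \<in> N w then slack else 0) \<le> c a" if "l a \<le> c a" for a
      using load_le[OF that] slack_le[of a] by auto
    fix v assume v: "v \<in> insert w F"
    show "\<exists>a\<in>N v. load a + (if a \<in> N w then slack else 0) = c a"
    proof (cases "v = w")
      case True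
      with b show ?thesis by (intro bexI[of _ b]) auto
    next
      case False
      with v y obtain a where a: "a \<in> N v" "load a = c a"
        by (auto simp: maximal_increment_def load_def)
      \<comment> \<open>raising the variable of \<open>w\<close> keeps tight constraints tight: the slack is 0 if \<open>a \<in> N w\<close>\<close>
      with slack_le[of a] slack_nonneg show ?thesis
        by (intro bexI[of _ a]) auto
    qed
  qed
  then show ?case by blast
qed

section \<open>The algorithm\<close>

definition dual_increment ::
  "('v, 'l) odsl \<Rightarrow> nat \<Rightarrow> 'v set \<Rightarrow> (('v, 'l) lease \<Rightarrow> real) \<Rightarrow> 'v \<Rightarrow> real" where
  "dual_increment I t D l =
     (SOME y. maximal_increment (lease_cost I) (\<lambda>v. candidates I (t, v)) D l y)"

text \<open>The list of request sets is reversed here, so that the most recent one is its head.\<close>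

primrec rev_load :: "('v, 'l) odsl \<Rightarrow> 'v set list \<Rightarrow> ('v, 'l) lease \<Rightarrow> real" where
  "rev_load I [] = (\<lambda>a. 0)"
| "rev_load I (D # Ds) = (\<lambda>a. rev_load I Ds a +
     (\<Sum>v | v \<in> D \<and> a \<in> candidates I (length Ds, v).
       dual_increment I (length Ds) D (rev_load I Ds) v))"

definition load :: "('v, 'l) odsl \<Rightarrow> 'v set list \<Rightarrow> ('v, 'l) lease \<Rightarrow> real" where
  "load I Ds = rev_load I (rev Ds)"

definition dual_alg :: "('v, 'l) online_dual" where
  "dual_alg I Ds = dual_increment I (length Ds - 1) (last Ds) (load I (butlast Ds))"

definition tight_leases :: "('v, 'l) odsl \<Rightarrow> 'v set list \<Rightarrow> nat \<Rightarrow> ('v, 'l) lease set" where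
  "tight_leases I Ds t = {a \<in> leases_at I t. load I (take (Suc t) Ds) a = lease_cost I a}"

definition lease_alg :: "('v, 'l) online_alg" where
  "lease_alg I Ds =
     tight_leases I Ds (length Ds - 1) - (\<Union>t<length Ds - 1. tight_leases I Ds t)"

lemma load_Nil: "load I [] a = 0"
  by (simp add: load_def)

lemma load_snoc:
  "load I (Ds @ [D]) a = load I Ds a +
     (\<Sum>v | v \<in> D \<and> a \<in> candidates I (length Ds, v). dual_alg I (Ds @ [D]) v)"
  by (simp add: load_def dual_alg_def)

lemma dual_alg_maximal_if_load_le:
  assumes I: "odsl_instance I" and Ds: "requests I (Ds @ [D])"
    and le: "\<And>a. 0 \<le> lease_cost I a \<Longrightarrow> load I Ds a \<le> lease_cost I a"
  shows "maximal_increment (lease_cost I) (\<lambda>v. candidates I (length Ds, v)) D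
    (load I Ds) (dual_alg I (Ds @ [D]))"
proof -
  have D: "D \<subseteq> pverts (network I)"
    using Ds by (simp add: requests_def)
  have "\<exists>y. maximal_increment (lease_cost I) (\<lambda>v. candidates I (length Ds, v)) D (load I Ds) y"
  proof (rule maximal_increment_exists)
    show "finite D"
      using D finite_pverts[OF I] by (rule finite_subset)
    show "finite (candidates I (length Ds, v)) \<and> candidates I (length Ds, v) \<noteq> {}"
      if "v \<in> D" for v
      using that D finite_candidates[OF I] candidates_nonempty[OF I] by blast
    show "load I Ds a \<le> lease_cost I a" if "a \<in> candidates I (length Ds, v)" for v a
      using that by (intro le lease_cost_nonneg[OF I] subsetD[OF candidates_subset])
  qed
  then show ?thesis
    by (simp add: dual_alg_def dual_increment_def someI_ex)
qed

lemma load_le_lease_cost: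
  assumes I: "odsl_instance I" and "requests I Ds" and "0 \<le> lease_cost I a"
  shows "load I Ds a \<le> lease_cost I a"
  using assms(2,3)
proof (induction Ds arbitrary: a rule: rev_induct)
  case Nil
  then show ?case by (simp add: load_Nil)
next
  case (snoc D Ds)
  have Ds: "requests I Ds"
    using snoc.prems(1) by (simp add: requests_def)
  show ?case
    using dual_alg_maximal_if_load_le[OF I snoc.prems(1) snoc.IH[OF Ds]]
      snoc.IH[OF Ds snoc.prems(2)]
    unfolding maximal_increment_def load_snoc by blast
qed

lemma requests_take: "requests I Ds \<Longrightarrow> requests I (take t Ds)"
  by (auto simp: requests_def dest: in_set_takeD)

lemma load_take_Suc:
  assumes "t < length Ds"
  shows "load I (take (Suc t) Ds) a = load I (take t Ds) a +
    (\<Sum>v | v \<in> Ds ! t \<and> a \<in> candidates I (t, v). dual_alg I (take (Suc t) Ds) v)"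
  using assms by (simp add: take_Suc_conv_app_nth load_snoc)

lemma dual_alg_maximal:
  assumes I: "odsl_instance I" and Ds: "requests I Ds" and t: "t < length Ds"
  shows "maximal_increment (lease_cost I) (\<lambda>v. candidates I (t, v)) (Ds ! t)
    (load I (take t Ds)) (dual_alg I (take (Suc t) Ds))"
proof -
  have eq: "take (Suc t) Ds = take t Ds @ [Ds ! t]"
    using t by (rule take_Suc_conv_app_nth)
  show ?thesis
    using dual_alg_maximal_if_load_le[OF I requests_take[OF Ds, of "Suc t", unfolded eq]]
      load_le_lease_cost[OF I requests_take[OF Ds]] t
    by (simp add: eq)
qed

lemma dual_solution_nonneg:
  assumes "odsl_instance I" "requests I Ds" "r \<in> constraints Ds"
  shows "0 \<le> dual_solution dual_alg I Ds r"
  using dual_alg_maximal[OF assms(1,2)] assms(3)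
  by (auto simp: dual_solution_def constraints_def maximal_increment_def)

lemma load_eq:
  assumes I: "odsl_instance I" and "requests I Ds"
  shows "load I Ds a =
    (\<Sum>r | r \<in> constraints Ds \<and> a \<in> candidates I r. dual_solution dual_alg I Ds r)"
  using assms(2)
proof (induction Ds rule: rev_induct)
  case Nil
  then show ?case by (simp add: load_Nil constraints_Nil)
next
  case (snoc D Ds)
  have Ds: "requests I Ds" and D: "finite D"
    using snoc.prems finite_pverts[OF I] by (auto simp: requests_def intro: finite_subset)
  let ?y = "dual_solution dual_alg I (Ds @ [D])"
  let ?old = "{r. r \<in> constraints Ds \<and> a \<in> candidates I r}"
  let ?new = "{v. v \<in> D \<and> a \<in> candidates I (length Ds, v)}"
  have "{r. r \<in> constraints (Ds @ [D]) \<and> a \<in> candidates I r} = ?old \<union> Pair (length Ds) ` ?new"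
    by (auto simp: constraints_snoc)
  moreover have "?old \<inter> Pair (length Ds) ` ?new = {}"
    by (auto simp: constraints_def)
  ultimately have "(\<Sum>r | r \<in> constraints (Ds @ [D]) \<and> a \<in> candidates I r. ?y r) =
      sum ?y ?old + sum ?y (Pair (length Ds) ` ?new)"
    using finite_constraints[OF I Ds] D by (simp add: sum.union_disjoint)
  also have "sum ?y ?old = load I Ds a"
    unfolding snoc.IH[OF Ds]
    by (intro sum.cong) (auto simp: dual_solution_def constraints_def)
  also have "sum ?y (Pair (length Ds) ` ?new) = (\<Sum>v\<in>?new. dual_alg I (Ds @ [D]) v)"
    by (subst sum.reindex) (auto simp: inj_on_def dual_solution_def)
  finally show ?case
    by (simp add: load_snoc)
qed

lemma dual_feasible_dual_alg:
  assumes I: "odsl_instance I" and Ds: "requests I Ds"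
  shows "dual_feasible I Ds (dual_solution dual_alg I Ds)"
  unfolding dual_feasible_def load_eq[OF I Ds, symmetric]
  using dual_solution_nonneg[OF I Ds] load_le_lease_cost[OF I Ds] lease_cost_nonneg[OF I]
  by (auto simp: leases_def)

lemma load_take_le:
  assumes I: "odsl_instance I" and Ds: "requests I Ds"
  shows "load I (take t Ds) a \<le> load I Ds a"
proof (cases "t \<le> length Ds")
  case True
  have "load I (take n Ds) a \<le> load I (take (Suc n) Ds) a" for n
    using dual_alg_maximal[OF I Ds]
    by (cases "n < length Ds") (auto simp: load_take_Suc maximal_increment_def intro: sum_nonneg)
  from lift_Suc_mono_le[of "\<lambda>n. load I (take n Ds) a", OF this True]
  show ?thesis by simp
qed simp

lemma load_eq_lease_cost:
  assumes I: "odsl_instance I" and Ds: "requests I Ds" and a: "a \<in> tight_leases I Ds t"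
  shows "load I Ds a = lease_cost I a"
  using load_take_le[OF I Ds, of "Suc t" a] a
    load_le_lease_cost[OF I Ds, of a] lease_cost_nonneg[OF I, of a t]
  by (simp add: tight_leases_def)

lemma purchases_lease_alg:
  assumes "t < length Ds"
  shows "purchases lease_alg I Ds t = disjointed (tight_leases I Ds) t"
proof -
  have "length (take (Suc t) Ds) = Suc t"
    using assms by simp
  then show ?thesis
    by (auto simp: purchases_def lease_alg_def disjointed_def tight_leases_def min_def)
qed

lemma purchases_subset: "t < length Ds \<Longrightarrow> purchases lease_alg I Ds t \<subseteq> leases_at I t"
  by (auto simp: purchases_lease_alg disjointed_def tight_leases_def)

lemma online_feasible_lease_alg:
  assumes I: "odsl_instance I" and Ds: "requests I Ds"
  shows "online_feasible lease_alg I Ds"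
  unfolding online_feasible_def served_iff
proof (intro allI impI conjI ballI)
  fix t assume t: "t < length Ds"
  then show "purchases lease_alg I Ds t \<subseteq> leases_at I t"
    by (rule purchases_subset)
  fix v assume "v \<in> Ds ! t"
  then obtain a where a: "a \<in> candidates I (t, v)" "load I (take (Suc t) Ds) a = lease_cost I a"
    using dual_alg_maximal[OF I Ds t] by (auto simp: maximal_increment_def load_take_Suc[OF t])
  then have "a \<in> tight_leases I Ds t"
    using candidates_subset by (fastforce simp: tight_leases_def)
  then have "a \<in> (\<Union>i\<in>{0..<Suc t}. disjointed (tight_leases I Ds) i)"
    unfolding finite_UN_disjointed_eq by auto
  also have "\<dots> = (\<Union>i\<le>t. purchases lease_alg I Ds i)"
    using t by (intro SUP_cong) (auto simp: purchases_lease_alg)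
  finally show "(\<Union>i\<le>t. purchases lease_alg I Ds i) \<inter> candidates I (t, v) \<noteq> {}"
    using a(1) by blast
qed

lemma primal_feasible_lease_alg:
  assumes I: "odsl_instance I" and Ds: "requests I Ds"
  shows "primal_feasible I Ds (primal_solution lease_alg I Ds)"
  unfolding primal_feasible_def
proof (intro conjI ballI)
  fix r assume "r \<in> constraints Ds"
  then obtain t v where r: "r = (t, v)" "t < length Ds" "v \<in> Ds ! t"
    by (auto simp: constraints_def)
  then obtain a i where a: "a \<in> candidates I r" "a \<in> purchases lease_alg I Ds i" "i \<le> t"
    using online_feasible_lease_alg[OF I Ds] by (fastforce simp: online_feasible_def served_iff)
  then have "primal_solution lease_alg I Ds a = 1"
    using r(2) by (auto simp: primal_solution_def intro!: exI[of _ i])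
  moreover have "primal_solution lease_alg I Ds a \<le>
      (\<Sum>a\<in>candidates I r. primal_solution lease_alg I Ds a)"
    using a(1) finite_candidates[OF I] r(1) by (intro member_le_sum) (auto simp: primal_solution_def)
  ultimately show "1 \<le> (\<Sum>a\<in>candidates I r. primal_solution lease_alg I Ds a)"
    by simp
qed (auto simp: primal_solution_def)

definition bought :: "('v, 'l) odsl \<Rightarrow> 'v set list \<Rightarrow> ('v, 'l) lease set" where
  "bought I Ds = (\<Union>t<length Ds. purchases lease_alg I Ds t)"

lemma bought_subset: "bought I Ds \<subseteq> leases I (length Ds)"
  unfolding bought_def leases_def by (intro UN_mono subset_refl purchases_subset) simp

lemma online_cost_lease_alg:
  assumes I: "odsl_instance I"
  shows "online_cost lease_alg I Ds = (\<Sum>a\<in>bought I Ds. lease_cost I a)"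
  unfolding online_cost_def bought_def
proof (rule sum.UNION_disjoint[symmetric])
  show "\<forall>t\<in>{..<length Ds}. finite (purchases lease_alg I Ds t)"
    by (auto intro: finite_subset[OF purchases_subset finite_leases_at[OF I]])
  show "\<forall>i\<in>{..<length Ds}. \<forall>j\<in>{..<length Ds}. i \<noteq> j \<longrightarrow>
      purchases lease_alg I Ds i \<inter> purchases lease_alg I Ds j = {}"
    using disjoint_family_disjointed[of "tight_leases I Ds"]
    by (auto simp: purchases_lease_alg disjoint_family_on_def)
qed simp

lemma primal_value_lease_alg:
  assumes I: "odsl_instance I"
  shows "primal_value I Ds (primal_solution lease_alg I Ds) = (\<Sum>a\<in>bought I Ds. lease_cost I a)"
proof -
  have "primal_solution lease_alg I Ds a = (if a \<in> bought I Ds then 1 else 0)" for a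
    by (auto simp: primal_solution_def bought_def)
  then have "primal_value I Ds (primal_solution lease_alg I Ds) =
      (\<Sum>a\<in>leases I (length Ds). if a \<in> bought I Ds then lease_cost I a else 0)"
    unfolding primal_value_def by (intro sum.cong) auto
  also have "\<dots> = (\<Sum>a\<in>leases I (length Ds) \<inter> bought I Ds. lease_cost I a)"
    by (rule sum.inter_restrict[OF finite_leases[OF I], symmetric])
  finally show ?thesis
    by (simp add: Int_absorb1[OF bought_subset])
qed

lemma bought_cost_le:
  assumes I: "odsl_instance I" and Ds: "requests I Ds"
  shows "(\<Sum>a\<in>bought I Ds. lease_cost I a) \<le>
    2 * (real (card (lease_types I)) * real (max 1 (max_degree I))) *
      dual_value Ds (dual_solution dual_alg I Ds)"
proof -
  let ?y = "dual_solution dual_alg I Ds"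
  let ?K = "2 * (real (card (lease_types I)) * real (max 1 (max_degree I)))"
  have fin: "finite (bought I Ds)" "finite (constraints Ds)"
    by (rule finite_subset[OF bought_subset finite_leases[OF I]], rule finite_constraints[OF I Ds])
  have "(\<Sum>a\<in>bought I Ds. lease_cost I a) =
      (\<Sum>a\<in>bought I Ds. \<Sum>r | r \<in> constraints Ds \<and> a \<in> candidates I r. ?y r)"
    unfolding load_eq[OF I Ds, symmetric]
    using load_eq_lease_cost[OF I Ds]
    by (intro sum.cong) (auto simp: bought_def purchases_lease_alg disjointed_def)
  also have "\<dots> = (\<Sum>r\<in>constraints Ds. \<Sum>a | a \<in> bought I Ds \<and> a \<in> candidates I r. ?y r)"
    using fin by (intro sum.swap_restrict)
  also have "\<dots> \<le> (\<Sum>r\<in>constraints Ds. ?K * ?y r)"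
  proof (rule sum_mono)
    fix r assume r: "r \<in> constraints Ds"
    obtain t v where tv: "r = (t, v)"
      by (cases r)
    have "card {a. a \<in> bought I Ds \<and> a \<in> candidates I r} \<le> card (candidates I r)"
      using finite_candidates[OF I] tv by (intro card_mono) auto
    also have "\<dots> \<le> (max_degree I + 1) * card (lease_types I)"
      using card_candidates_le[OF I requested_in_pverts[OF Ds]] r tv by simp
    also have "\<dots> \<le> 2 * max 1 (max_degree I) * card (lease_types I)"
      by (intro mult_right_mono) auto
    finally have "real (card {a. a \<in> bought I Ds \<and> a \<in> candidates I r}) \<le>
        real (2 * max 1 (max_degree I) * card (lease_types I))"
      by (simp only: of_nat_le_iff)
    also have "\<dots> = ?K"
      by simp
    finally show "(\<Sum>a | a \<in> bought I Ds \<and> a \<in> candidates I r. ?y r) \<le> ?K * ?y r"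
      using dual_solution_nonneg[OF I Ds r] by (simp only: sum_constant mult_right_mono)
  qed
  also have "\<dots> = ?K * dual_value Ds ?y"
    by (simp add: dual_value_def sum_distrib_left)
  finally show ?thesis .
qed

theorem theorem2:
  shows "\<exists>(A :: ('v, 'l) online_alg) (Y :: ('v, 'l) online_dual).
    primal_dual (\<lambda>I. real (card (lease_types I)) * real (max 1 (max_degree I))) A Y \<and>
    competitive (\<lambda>I. real (card (lease_types I)) * real (max 1 (max_degree I))) A"
proof (intro exI conjI)
  let ?f = "\<lambda>I :: ('v, 'l) odsl. real (card (lease_types I)) * real (max 1 (max_degree I))"
  show "primal_dual ?f lease_alg dual_alg"
    unfolding primal_dual_def
    by (intro exI[of _ 2] conjI allI impI)
      (simp_all only: primal_feasible_lease_alg dual_feasible_dual_alg online_cost_lease_alg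
        primal_value_lease_alg bought_cost_le zero_less_numeral)
  have "online_cost lease_alg I Ds \<le> 2 * ?f I * Opt I Ds"
    if I: "odsl_instance I" and Ds: "requests I Ds" for I :: "('v, 'l) odsl" and Ds
  proof -
    have "online_cost lease_alg I Ds \<le> 2 * ?f I * dual_value Ds (dual_solution dual_alg I Ds)"
      unfolding online_cost_lease_alg[OF I] by (rule bought_cost_le[OF I Ds])
    also have "\<dots> \<le> 2 * ?f I * Opt I Ds"
      by (intro mult_left_mono dual_value_le_Opt[OF I Ds dual_feasible_dual_alg[OF I Ds]]) simp
    finally show ?thesis .
  qed
  then show "competitive ?f lease_alg"
    unfolding competitive_def
    using online_feasible_lease_alg by (intro exI[of _ 2]) auto
qed

end
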